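(* Consider the linear program in the variables $p_q(s_i)$, $i=1,\dots,H$, with given constants $p(Z=0\mid s_i)$ and $u$: $$\max_{p_q(s_i)}\ \sum_{i} p(Z=0\mid s_i)^2\,p_q(s_i)\quad\text{subject to}\quad \sum_i p(Z=0\mid s_i)\,p_q(s_i)=u,\quad \sum_i p_q(s_i)=1,\quad p_q(s_i)\ge 0 .$$ The optimal solution $p_{q^*}(s_i)$ to this linear program is $$p_{q^*}(s_{q_0})=\frac{u-p(Z=0\mid s_{q_1})}{p(Z=0\mid s_{q_0})-p(Z=0\mid s_{q_1})},\qquad p_{q^*}(s_{q_1})=\frac{p(Z=0\mid s_{q_0})-u}{p(Z=0\mid s_{q_0})-p(Z=0\mid s_{q_1})},$$ $$p_{q^*}(s_i)=0\quad\forall i\notin\{q_0,q_1\},$$ where $$q_0=\arg\min_i\,[p(Z=0\mid s_i)]=\arg\max_i\,[p(Z=1\mid s_i)],\qquad q_1=\arg\max_i\,[p(Z=0\mid s_i)].$$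
   Context: $(S,Z)\in\mathbb{R}^d\times\{0,1\}$ is a random feature-label pair with joint density $p(s,z)$; $p(s)$ is the marginal density of the feature and $p(Z=z\mid s)$ is the posterior probability of label $z$ given feature $s$. The constant $u\in[0,1]$ is the class prior probability of $Z=0$: it is the limit of the fraction of class-zero points in the sample as the sample size tends to infinity (the usual limiting regime). A marginal feature distribution $p_q$ is to be optimized. It is discretized by partitioning its support into balls $B(s_i,r)\subseteq\mathbb{R}^d$ of radius $r$ centered at points $s_i$, which gives the discrete quantities $p(Z=0\mid s_i)=\int_{B(s_i,r)}p(Z=0\mid s)\,p(s)\,ds$. $H$ denotes the number of variables $p_q(s_i)$. The $p(Z=0\mid s_i)$ are constant coefficients in the linear program, and $p(Z=1\mid s_i)=1-p(Z=0\mid s_i)$.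
   Formalization: Assumes that the linear program has a feasible point (otherwise the formula can give negative entries) and that the smallest and largest p(Z=0|s_i) differ; uniqueness of the optimal solution is claimed only when the arg min and arg max are single indices, since it can fail under ties. *)

theory Defs
  imports Complex_Main
begin

text \<open>
  In the definitions below, \<open>c i\<close> is the coefficient \<open>p(Z = 0 | s\<^sub>i)\<close> and \<open>p i\<close> is the
  variable \<open>p\<^sub>q(s\<^sub>i)\<close>, for \<open>i = 1, \<dots>, H\<close>; values at other indices play no role.
\<close>

definition lp_objective :: "nat \<Rightarrow> (nat \<Rightarrow> real) \<Rightarrow> (nat \<Rightarrow> real) \<Rightarrow> real" where
  "lp_objective H c p = (\<Sum>i = 1..H. (c i)\<^sup>2 * p i)"

definition lp_feasible :: "nat \<Rightarrow> (nat \<Rightarrow> real) \<Rightarrow> real \<Rightarrow> (nat \<Rightarrow> real) \<Rightarrow> bool" where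
  "lp_feasible H c u p \<longleftrightarrow>
     (\<Sum>i = 1..H. c i * p i) = u \<and> (\<Sum>i = 1..H. p i) = 1 \<and> (\<forall>i \<in> {1..H}. p i \<ge> 0)"

definition lp_optimal :: "nat \<Rightarrow> (nat \<Rightarrow> real) \<Rightarrow> real \<Rightarrow> (nat \<Rightarrow> real) \<Rightarrow> bool" where
  "lp_optimal H c u p \<longleftrightarrow> is_arg_max (lp_objective H c) (lp_feasible H c u) p"

definition p_star :: "(nat \<Rightarrow> real) \<Rightarrow> real \<Rightarrow> nat \<Rightarrow> nat \<Rightarrow> nat \<Rightarrow> real" where
  "p_star c u q0 q1 i =
     (if i = q0 then (u - c q1) / (c q0 - c q1)
      else if i = q1 then (c q0 - u) / (c q0 - c q1)
      else 0)"

end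

theory Submission
  imports Defs
begin

text \<open>
  Write \<open>a\<close> and \<open>b\<close> for the extreme coefficients. On the feasible set the two equality constraints
  turn \<open>x\<^sup>2 = (a + b) x - a b - (x - a) (b - x)\<close> into: the objective is the constant
  \<open>(a + b) u - a b\<close> minus the sum of the terms \<open>(c i - a) (b - c i) p i\<close>, all of them nonnegative.
  Hence a feasible point supported on the indices where \<open>c\<close> is extreme is optimal, and every
  optimal point is supported there.
\<close>

lemma lp_objective_gap:
  assumes "lp_feasible H c u p"
  shows "lp_objective H c p = (a + b) * u - a * b - (\<Sum>i = 1..H. (c i - a) * (b - c i) * p i)"
proof -
  have "lp_objective H c p =
      (\<Sum>i = 1..H. (a + b) * (c i * p i) - a * b * p i - (c i - a) * (b - c i) * p i)"
    unfolding lp_objective_def by (intro sum.cong) (auto simp: algebra_simps power2_eq_square)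
  also have "\<dots> = (a + b) * (\<Sum>i = 1..H. c i * p i) - a * b * (\<Sum>i = 1..H. p i)
      - (\<Sum>i = 1..H. (c i - a) * (b - c i) * p i)"
    by (simp only: sum_subtractf sum_distrib_left)
  finally show ?thesis
    using assms by (simp add: lp_feasible_def)
qed

text \<open>The weights \<open>p i\<close> are nonnegative and sum to 1, so \<open>u\<close> is a
  convex combination of the coefficients and cannot leave an interval that contains them
  all.\<close>

lemma lp_feasible_mean_bounds:
  assumes "lp_feasible H c u p" and "\<And>i. i \<in> {1..H} \<Longrightarrow> a \<le> c i \<and> c i \<le> b"
  shows "a \<le> u" and "u \<le> b"
proof -
  have p: "(\<Sum>i = 1..H. c i * p i) = u" "(\<Sum>i = 1..H. p i) = 1" "\<And>i. i \<in> {1..H} \<Longrightarrow> 0 \<le> p i"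
    using assms(1) by (auto simp: lp_feasible_def)
  have "(\<Sum>i = 1..H. a * p i) \<le> (\<Sum>i = 1..H. c i * p i)"
    using assms(2) p(3) by (intro sum_mono mult_right_mono) auto
  then show "a \<le> u"
    using p(1,2) by (simp flip: sum_distrib_left)
  have "(\<Sum>i = 1..H. c i * p i) \<le> (\<Sum>i = 1..H. b * p i)"
    using assms(2) p(3) by (intro sum_mono mult_right_mono) auto
  then show "u \<le> b"
    using p(1,2) by (simp flip: sum_distrib_left)
qed

lemma sum_two_points:
  fixes f :: "'a \<Rightarrow> 'b::comm_monoid_add"
  assumes "finite A" "x \<in> A" "y \<in> A" "x \<noteq> y" and "\<And>i. i \<in> A - {x, y} \<Longrightarrow> f i = 0"
  shows "sum f A = f x + f y"
proof -
  have "sum f A = sum f {x, y}"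
    using assms by (intro sum.mono_neutral_right) auto
  then show ?thesis
    using assms(4) by simp
qed

text \<open>This is Cramer's rule for a 2 by 2 system with determinant \<open>a - b\<close>; it is
  the origin of the two quotients in \<open>p_star\<close>.\<close>

lemma two_point_weights:
  fixes a b u x y :: real
  assumes "a \<noteq> b"
  shows "a * x + b * y = u \<and> x + y = 1 \<longleftrightarrow> x = (u - b) / (a - b) \<and> y = (a - u) / (a - b)"
proof
  assume "a * x + b * y = u \<and> x + y = 1"
  then have "u = a * x + b * y" and y: "y = 1 - x"
    by simp_all
  then have "x * (a - b) = u - b" "y * (a - b) = a - u"
    unfolding y by (simp_all add: algebra_simps)
  then show "x = (u - b) / (a - b) \<and> y = (a - u) / (a - b)"
    using assms by (simp add: eq_divide_eq)
next
  assume "x = (u - b) / (a - b) \<and> y = (a - u) / (a - b)"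
  then have "x * (a - b) = u - b" "y * (a - b) = a - u"
    using assms by simp_all
  \<comment> \<open>Multiplying by \<open>a - b\<close> clears the denominators and leaves
    polynomial identities; the factor is then cancelled.\<close>
  then have "(a * x + b * y) * (a - b) = u * (a - b)" "(x + y) * (a - b) = 1 * (a - b)"
    by algebra+
  then show "a * x + b * y = u \<and> x + y = 1"
    using assms by simp
qed

text \<open>On two support points the equality constraints determine both weights. The direction
  from right to left gives feasibility of \<open>p_star\<close>, the other one uniqueness of the
  optimum.\<close>

lemma two_point_feasible_iff:
  assumes "q0 \<in> {1..H}" "q1 \<in> {1..H}" and "c q0 < c q1" and "c q0 \<le> u" "u \<le> c q1"
    and "\<And>i. i \<in> {1..H} - {q0, q1} \<Longrightarrow> p i = 0"
  shows "lp_feasible H c u p \<longleftrightarrow> (\<forall>i\<in>{1..H}. p i = p_star c u q0 q1 i)"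
proof -
  have ne: "q0 \<noteq> q1" using assms(3) by auto
  have sums: "(\<Sum>i = 1..H. c i * p i) = c q0 * p q0 + c q1 * p q1" "(\<Sum>i = 1..H. p i) = p q0 + p q1"
    using assms(1,2,6) ne by (intro sum_two_points; simp)+
  \<comment> \<open>In both quotients the numerator is at most 0 and the denominator is
    negative.\<close>
  have nonneg: "0 \<le> p_star c u q0 q1 i" for i
    using assms(3-5) by (auto simp: p_star_def intro: divide_nonpos_neg)
  have "lp_feasible H c u p \<longleftrightarrow>
      (c q0 * p q0 + c q1 * p q1 = u \<and> p q0 + p q1 = 1) \<and> (\<forall>i\<in>{1..H}. 0 \<le> p i)"
    by (simp only: lp_feasible_def sums conj_assoc)
  also have "\<dots> \<longleftrightarrow> (p q0 = p_star c u q0 q1 q0 \<and> p q1 = p_star c u q0 q1 q1)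
      \<and> (\<forall>i\<in>{1..H}. 0 \<le> p i)"
    using assms(3) ne by (subst two_point_weights) (auto simp: p_star_def)
  also have "\<dots> \<longleftrightarrow> (\<forall>i\<in>{1..H}. p i = p_star c u q0 q1 i)"
  proof (intro iffI conjI ballI)
    fix i
    assume *: "(p q0 = p_star c u q0 q1 q0 \<and> p q1 = p_star c u q0 q1 q1) \<and> (\<forall>i\<in>{1..H}. 0 \<le> p i)"
      and "i \<in> {1..H}"
    then show "p i = p_star c u q0 q1 i"
      using assms(6)[of i] by (cases "i \<in> {q0, q1}") (auto simp: p_star_def)
  qed (use assms(1,2) nonneg in auto)
  finally show ?thesis .
qed

theorem theorem2:
  fixes H q0 q1 :: nat and c :: "nat \<Rightarrow> real" and u :: real
  assumes "\<forall>i \<in> {1..H}. 0 \<le> c i \<and> c i \<le> 1"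
    and "0 \<le> u" and "u \<le> 1"
    and "\<exists>p. lp_feasible H c u p"
    and "is_arg_min c (\<lambda>i. i \<in> {1..H}) q0"
    and "is_arg_max c (\<lambda>i. i \<in> {1..H}) q1"
    and "c q0 \<noteq> c q1"
  shows "(\<forall>i. is_arg_min c (\<lambda>i. i \<in> {1..H}) i \<longleftrightarrow>
               is_arg_max (\<lambda>i. 1 - c i) (\<lambda>i. i \<in> {1..H}) i)
    \<and> lp_optimal H c u (p_star c u q0 q1)
    \<and> ((\<exists>!i. is_arg_min c (\<lambda>i. i \<in> {1..H}) i) \<and> (\<exists>!i. is_arg_max c (\<lambda>i. i \<in> {1..H}) i)
        \<longrightarrow> (\<forall>p. lp_optimal H c u p \<longrightarrow> (\<forall>i \<in> {1..H}. p i = p_star c u q0 q1 i)))"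
proof -
  let ?gap = "\<lambda>p i. (c i - c q0) * (c q1 - c i) * p i"
  let ?top = "(c q0 + c q1) * u - c q0 * c q1"
  have q: "q0 \<in> {1..H}" "q1 \<in> {1..H}"
    and bounds: "\<And>i. i \<in> {1..H} \<Longrightarrow> c q0 \<le> c i \<and> c i \<le> c q1"
    using assms(5,6) by (auto simp: is_arg_min_linorder is_arg_max_linorder)
  then have lt: "c q0 < c q1"
    using assms(7) by force
  \<comment> \<open>The assumed feasible point places \<open>u\<close> between the extreme
    coefficients.\<close>
  have u: "c q0 \<le> u" "u \<le> c q1"
    using assms(4) lp_feasible_mean_bounds bounds by blast+
  have star: "lp_feasible H c u (p_star c u q0 q1)"
    using two_point_feasible_iff[OF q lt u, of "p_star c u q0 q1"] by (auto simp: p_star_def)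
  have gap_nonneg: "0 \<le> ?gap p i" if "lp_feasible H c u p" "i \<in> {1..H}" for p i
    using that bounds[of i] by (auto simp: lp_feasible_def)
  have le_top: "lp_objective H c p \<le> ?top" if "lp_feasible H c u p" for p
    using lp_objective_gap[OF that, of "c q0" "c q1"] sum_nonneg[of "{1..H}" "?gap p"]
      gap_nonneg[OF that] by simp
  \<comment> \<open>The first factor vanishes at \<open>q0\<close>, the second at \<open>q1\<close>,
    and the weight everywhere else.\<close>
  have "(\<Sum>i = 1..H. ?gap (p_star c u q0 q1) i) = 0"
    by (intro sum.neutral) (auto simp: p_star_def)
  then have star_top: "lp_objective H c (p_star c u q0 q1) = ?top"
    using lp_objective_gap[OF star, of "c q0" "c q1"] by simp
  have optimal: "lp_optimal H c u (p_star c u q0 q1)"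
    using star le_top star_top by (auto simp: lp_optimal_def is_arg_max_linorder)
  have unique: "\<forall>i\<in>{1..H}. p i = p_star c u q0 q1 i"
    if ex1: "\<exists>!i. is_arg_min c (\<lambda>i. i \<in> {1..H}) i" "\<exists>!i. is_arg_max c (\<lambda>i. i \<in> {1..H}) i"
      and opt: "lp_optimal H c u p" for p
  proof -
    \<comment> \<open>Comparison with the feasible point \<open>p_star\<close>, whose value is
      \<open>?top\<close>, leaves an optimal \<open>p\<close> no positive gap.\<close>
    have p: "lp_feasible H c u p" and "?top \<le> lp_objective H c p"
      using opt star star_top by (auto simp: lp_optimal_def is_arg_max_linorder)
    then have "(\<Sum>i = 1..H. ?gap p i) \<le> 0"
      using lp_objective_gap[OF p, of "c q0" "c q1"] by simp
    then have "(\<Sum>i = 1..H. ?gap p i) = 0"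
      using sum_nonneg[of "{1..H}" "?gap p"] gap_nonneg[OF p] by force
    then have gap0: "?gap p i = 0" if "i \<in> {1..H}" for i
      using sum_nonneg_eq_0_iff[of "{1..H}" "?gap p"] gap_nonneg[OF p] that by auto
    have "p i = 0" if i: "i \<in> {1..H} - {q0, q1}" for i
    proof -
      \<comment> \<open>Since \<open>q0\<close> and \<open>q1\<close> are the only extremal indices,
        \<open>c i\<close> lies strictly between the extremes, so a zero gap term forces
        \<open>p i = 0\<close>.\<close>
      have "\<not> is_arg_min c (\<lambda>i. i \<in> {1..H}) i" "\<not> is_arg_max c (\<lambda>i. i \<in> {1..H}) i"
        using ex1 assms(5,6) i by blast+
      then have "c i \<noteq> c q0" "c i \<noteq> c q1"
        using i bounds by (auto simp: is_arg_min_linorder is_arg_max_linorder)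
      then show ?thesis
        using gap0[of i] i by simp
    qed
    then show ?thesis
      using two_point_feasible_iff[OF q lt u] p by blast
  qed
  \<comment> \<open>The map sending \<open>x\<close> to \<open>1 - x\<close> reverses the
    order.\<close>
  have "is_arg_min c (\<lambda>i. i \<in> {1..H}) i \<longleftrightarrow> is_arg_max (\<lambda>i. 1 - c i) (\<lambda>i. i \<in> {1..H}) i" for i
    by (simp add: is_arg_min_linorder is_arg_max_linorder)
  then show ?thesis
    using optimal unique by blast
qed

end
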